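(* Let $d\ge2$ and let $Q$ be a qplex. Then the preservation group $\mathcal{G}(Q)$ is a group under matrix multiplication, and it is the symmetry group of $Q$: for every $R\in\mathcal{G}(Q)$ the map $q\mapsto Rq$ is a distance-preserving bijection of $Q$ onto itself, and conversely every distance-preserving bijection $f:Q\to Q$ (with respect to the Euclidean distance) is of the form $f(q)=Rq$ for some $R\in\mathcal{G}(Q)$.
   Context: Fix an integer $d\ge 2$. $\langle\cdot,\cdot\rangle$ is the standard inner product on $\mathbb{R}^{d^2}$, $\|\cdot\|$ the Euclidean norm. $\Delta=\{p\in\mathbb{R}^{d^2}: p(i)\ge0,\ \sum_ip(i)=1\}$; $H=\{u\in\mathbb{R}^{d^2}:\sum_i u(i)=1\}$; $c=(1/d^2,\dots,1/d^2)$. For $A\subseteq H$ the polar is $A^*=\{u\in H:\langle u,v\rangle\ge\frac{1}{d(d+1)}\ \forall v\in A\}$. Out-ball $B_{\rm o}=\{u\in H:\|u-c\|\le r_{\rm o}\}$, $r_{\rm o}^2=\frac{d-1}{d^2(d+1)}$. A qplex is a set $Q\subseteq\Delta\cap B_{\rm o}$ with $Q^*=Q$. A measurement (with $d^2$ outcomes) is an array of reals $r(i|j)\ge0$ with $\sum_i r(i|j)=1$ for every $j$. For $q\in Q$, $q_r(i)=\sum_j\big[(d+1)q(j)-\frac1d\big]r(i|j)$ and $Q_r=\{q_r:q\in Q\}$; the measurement is $Q$-preserving if $Q_r=Q$. Its stretched measurement matrix is $R_{ij}=(d+1)r(i|j)-\frac1d\sum_k r(i|k)$, so that $q_r=Rq$.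 The preservation group $\mathcal{G}(Q)$ is the set of stretched measurement matrices of $Q$-preserving measurements. *)

theory Defs
  imports "HOL-Analysis.Analysis" "HOL-Algebra.Group"
begin

text \<open>Vectors in R^(d^2) are modelled as real^'n with CARD('n) = d^2;
  matrices as real^'n^'n.\<close>

definition prob_simplex :: "(real^'n::finite) set" where
  "prob_simplex = {p. (\<forall>i. p$i \<ge> 0) \<and> (\<Sum>i\<in>UNIV. p$i) = 1}"

definition hyperH :: "(real^'n::finite) set" where
  "hyperH = {u. (\<Sum>i\<in>UNIV. u$i) = 1}"

definition centre :: "nat \<Rightarrow> real^'n::finite" where
  "centre d = (\<chi> i. 1 / (real d)^2)"

definition polar :: "nat \<Rightarrow> (real^'n::finite) set \<Rightarrow> (real^'n) set" where
  "polar d A = {u \<in> hyperH. \<forall>v\<in>A. inner u v \<ge> 1 / (real d * (real d + 1))}"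

definition out_ball :: "nat \<Rightarrow> (real^'n::finite) set" where
  "out_ball d = {u \<in> hyperH. (norm (u - centre d))^2 \<le> (real d - 1) / ((real d)^2 * (real d + 1))}"

definition qplex :: "nat \<Rightarrow> (real^'n::finite) set \<Rightarrow> bool" where
  "qplex d Q \<longleftrightarrow> Q \<subseteq> prob_simplex \<inter> out_ball d \<and> polar d Q = Q"

definition measurement :: "('n::finite \<Rightarrow> 'n \<Rightarrow> real) \<Rightarrow> bool" where
  "measurement r \<longleftrightarrow> (\<forall>i j. r i j \<ge> 0) \<and> (\<forall>j. (\<Sum>i\<in>UNIV. r i j) = 1)"

text \<open>q_r(i) = sum_j [(d+1) q(j) - 1/d] r(i|j); here r i j stands for r(i|j).\<close>
definition meas_apply :: "nat \<Rightarrow> ('n::finite \<Rightarrow> 'n \<Rightarrow> real) \<Rightarrow> real^'n \<Rightarrow> real^'n" where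
  "meas_apply d r q = (\<chi> i. \<Sum>j\<in>UNIV. ((real d + 1) * q$j - 1 / real d) * r i j)"

definition Q_preserving :: "nat \<Rightarrow> (real^'n::finite) set \<Rightarrow> ('n \<Rightarrow> 'n \<Rightarrow> real) \<Rightarrow> bool" where
  "Q_preserving d Q r \<longleftrightarrow> measurement r \<and> meas_apply d r ` Q = Q"

definition stretched :: "nat \<Rightarrow> ('n::finite \<Rightarrow> 'n \<Rightarrow> real) \<Rightarrow> real^'n^'n" where
  "stretched d r = (\<chi> i j. (real d + 1) * r i j - (1 / real d) * (\<Sum>k\<in>UNIV. r i k))"

definition preservation_group :: "nat \<Rightarrow> (real^'n::finite) set \<Rightarrow> (real^'n^'n) set" where
  "preservation_group d Q = {stretched d r | r. Q_preserving d Q r}"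

end

theory Submission
  imports Defs
begin

text \<open>In the stretched coordinates stretch q = (d + 1) q - 1/d, the vertices (the preimages of
  the standard basis vectors) lie in Q, every point of the hyperplane H is an affine combination
  of them, and a measurement acts on H linearly through the matrix A = (d + 1) r(i|j) - 1/d.
  The out-ball condition says precisely that stretched points of Q have norm at most 1.
  If the measurement maps Q onto Q, then A has a right inverse whose columns, like those of A,
  are stretched points of Q; comparing Frobenius norms with the trace forces A to be orthogonal,
  so the measurement is an isometry. Conversely, an isometry of Q preserves affine combinations,
  hence is the measurement whose columns are the images of the vertices. As matrices are
  determined by their action on the vertices, the preservation group is exactly the group of
  symmetries of Q.\<close>

definition stretch :: "nat \<Rightarrow> real^'n::finite \<Rightarrow> real^'n" where
  "stretch d q = (\<chi> j. (real d + 1) * q $ j - 1 / real d)"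

definition unstretch :: "nat \<Rightarrow> real^'n::finite \<Rightarrow> real^'n" where
  "unstretch d x = (\<chi> j. (x $ j + 1 / real d) / (real d + 1))"

definition vertex :: "nat \<Rightarrow> 'n::finite \<Rightarrow> real^'n" where
  "vertex d j = unstretch d (axis j 1)"

text \<open>On H the stretched measurement matrix acts as unstretch \<circ> (stretch_matrix d r *v) \<circ> stretch.\<close>
definition stretch_matrix :: "nat \<Rightarrow> ('n::finite \<Rightarrow> 'n \<Rightarrow> real) \<Rightarrow> real^'n^'n" where
  "stretch_matrix d r = (\<chi> i j. (real d + 1) * r i j - 1 / real d)"

definition symmetry :: "'a::metric_space set \<Rightarrow> ('a \<Rightarrow> 'a) \<Rightarrow> bool" where
  "symmetry S f \<longleftrightarrow> f ` S = S \<and> (\<forall>x\<in>S. \<forall>y\<in>S. dist (f x) (f y) = dist x y)"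

lemma symmetry_iff_bij_betw:
  "symmetry S f \<longleftrightarrow> bij_betw f S S \<and> (\<forall>x\<in>S. \<forall>y\<in>S. dist (f x) (f y) = dist x y)"
  by (auto simp: symmetry_def bij_betw_def inj_on_def) (metis dist_eq_0_iff)

lemma symmetry_id: "symmetry S (\<lambda>x. x)"
  by (simp add: symmetry_def)

lemma symmetry_comp:
  assumes f: "symmetry S f" and g: "symmetry S g"
  shows "symmetry S (\<lambda>x. f (g x))"
proof -
  have "(\<lambda>x. f (g x)) ` S = f ` (g ` S)" by (simp add: image_image)
  moreover have "g x \<in> S" if "x \<in> S" for x using g that by (auto simp: symmetry_def)
  ultimately show ?thesis using f g by (simp add: symmetry_def)
qed

lemma symmetry_inv_into:
  assumes f: "symmetry S f"
  shows "symmetry S (inv_into S f)"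
proof -
  have onto: "f ` S = S" using f by (simp add: symmetry_def)
  have "bij_betw (inv_into S f) S S"
    using f by (simp add: symmetry_iff_bij_betw bij_betw_inv_into)
  moreover have "dist (inv_into S f x) (inv_into S f y) = dist x y" if "x \<in> S" "y \<in> S" for x y
  proof -
    have "inv_into S f x \<in> S" "inv_into S f y \<in> S"
      using that onto by (auto intro: inv_into_into)
    then have "dist (inv_into S f x) (inv_into S f y)
        = dist (f (inv_into S f x)) (f (inv_into S f y))"
      using f by (simp add: symmetry_def)
    also have "\<dots> = dist x y" using that onto by (simp add: f_inv_into_f)
    finally show ?thesis .
  qed
  ultimately show ?thesis by (simp add: symmetry_iff_bij_betw)
qed

lemma inner_diff_diff_eq_dist:
  fixes x y z :: "'a::real_inner"
  shows "inner (x - y) (x - z) = ((dist x y)^2 + (dist x z)^2 - (dist y z)^2) / 2"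
  by (simp add: dist_norm power2_norm_eq_inner inner_diff_left inner_diff_right inner_commute
      algebra_simps)

lemma power2_norm_sum_scaleR:
  fixes y :: "'i \<Rightarrow> 'a::real_inner"
  shows "(norm (\<Sum>k\<in>S. a k *\<^sub>R y k))^2 = (\<Sum>j\<in>S. \<Sum>k\<in>S. a j * a k * inner (y j) (y k))"
  by (simp add: power2_norm_eq_inner inner_sum_left inner_sum_right mult_ac sum_distrib_left
      inner_commute)

lemma diff_sum_scaleR:
  fixes w :: "'i \<Rightarrow> 'a::real_vector"
  assumes "sum a S = 1"
  shows "x - (\<Sum>k\<in>S. a k *\<^sub>R w k) = (\<Sum>k\<in>S. a k *\<^sub>R (x - w k))"
  using assms by (simp add: scaleR_diff_right sum_subtractf flip: scaleR_sum_left)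

text \<open>The squared norm of p - \<Sum>a k v k is a quadratic form in the inner products
  (p - v j)\<bullet>(p - v k), which only depend on pairwise distances.\<close>
lemma isometry_affine_combination:
  fixes f :: "'a::real_inner \<Rightarrow> 'b::real_inner"
  assumes iso: "\<And>x y. x \<in> A \<Longrightarrow> y \<in> A \<Longrightarrow> dist (f x) (f y) = dist x y"
    and p: "p \<in> A" and v: "\<And>k. k \<in> S \<Longrightarrow> v k \<in> A" and a: "sum a S = 1"
    and p_eq: "p = (\<Sum>k\<in>S. a k *\<^sub>R v k)"
  shows "f p = (\<Sum>k\<in>S. a k *\<^sub>R f (v k))"
proof -
  have inner_eq: "inner (f p - f (v j)) (f p - f (v k)) = inner (p - v j) (p - v k)"
    if "j \<in> S" "k \<in> S" for j k
    using iso[OF p v[OF that(1)]] iso[OF p v[OF that(2)]] iso[OF v[OF that(1)] v[OF that(2)]]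
    by (simp add: inner_diff_diff_eq_dist)
  note diff_sum = diff_sum_scaleR[OF a]
  have "(norm (f p - (\<Sum>k\<in>S. a k *\<^sub>R f (v k))))^2
      = (\<Sum>j\<in>S. \<Sum>k\<in>S. a j * a k * inner (f p - f (v j)) (f p - f (v k)))"
    unfolding diff_sum power2_norm_sum_scaleR ..
  also have "\<dots> = (\<Sum>j\<in>S. \<Sum>k\<in>S. a j * a k * inner (p - v j) (p - v k))"
    by (intro sum.cong refl) (simp add: inner_eq)
  also have "\<dots> = (norm (p - (\<Sum>k\<in>S. a k *\<^sub>R v k)))^2"
    unfolding diff_sum power2_norm_sum_scaleR ..
  also have "\<dots> = 0" using p_eq by simp
  finally show ?thesis by simp
qed

lemma matrix_eq_if_eq_on_basis:
  fixes A B :: "real^'n::finite^'m"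
  assumes "\<And>j. A *v axis j 1 = B *v axis j 1"
  shows "A = B"
  using assms unfolding matrix_vector_mult_basis by (simp add: column_def vec_eq_iff)

lemma power2_norm_column: "(norm (column j A))^2 = (\<Sum>i\<in>UNIV. (A $ i $ j)^2)"
  unfolding power2_norm_eq_inner by (simp add: inner_vec_def column_def power2_eq_square)

text \<open>With column norms at most 1 the Frobenius norms of A and W are at most n = trace (A W),
  so the sum of squares of the entries of A - transpose W vanishes.\<close>
lemma orthogonal_matrix_if_right_inverse_columns_le_1:
  fixes A W :: "real^'n::finite^'n"
  assumes AW: "A ** W = mat 1"
    and A: "\<And>j. norm (column j A) \<le> 1" and W: "\<And>j. norm (column j W) \<le> 1"
  shows "orthogonal_matrix A"
proof -
  have frobenius: "(\<Sum>j\<in>UNIV. \<Sum>i\<in>UNIV. (M $ i $ j)^2) \<le> real CARD('n)"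
    if "\<And>j. norm (column j M) \<le> 1" for M :: "real^'n^'n"
  proof -
    have "(\<Sum>j\<in>UNIV. \<Sum>i\<in>UNIV. (M $ i $ j)^2) = (\<Sum>j\<in>UNIV. (norm (column j M))^2)"
      by (simp add: power2_norm_column)
    also have "\<dots> \<le> (\<Sum>j\<in>(UNIV::'n set). 1)"
      using that by (intro sum_mono) (simp add: power_le_one)
    finally show ?thesis by simp
  qed
  have trace: "(\<Sum>i\<in>UNIV. \<Sum>j\<in>UNIV. A $ i $ j * W $ j $ i) = real CARD('n)"
  proof -
    have "(\<Sum>i\<in>UNIV. \<Sum>j\<in>UNIV. A $ i $ j * W $ j $ i) = (\<Sum>i\<in>(UNIV::'n set). (A ** W) $ i $ i)"
      by (simp add: matrix_matrix_mult_def)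
    then show ?thesis by (simp add: AW mat_def)
  qed
  have "(\<Sum>i\<in>UNIV. \<Sum>j\<in>UNIV. (A $ i $ j - W $ j $ i)^2)
      = (\<Sum>i\<in>UNIV. \<Sum>j\<in>UNIV. (A $ i $ j)^2) + (\<Sum>i\<in>UNIV. \<Sum>j\<in>UNIV. (W $ j $ i)^2)
        - 2 * (\<Sum>i\<in>UNIV. \<Sum>j\<in>UNIV. A $ i $ j * W $ j $ i)"
    by (simp add: power2_diff sum.distrib sum_subtractf sum_distrib_left mult.assoc)
  also have "\<dots> \<le> 0"
    using frobenius[OF A] frobenius[OF W] trace sum.swap[of "\<lambda>i j. (A $ i $ j)^2" UNIV UNIV]
    by linarith
  finally have "(\<Sum>i\<in>UNIV. \<Sum>j\<in>UNIV. (A $ i $ j - W $ j $ i)^2) = 0"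
    by (intro order.antisym sum_nonneg) auto
  then have "\<forall>i j. A $ i $ j = W $ j $ i"
    by (simp add: sum_nonneg_eq_0_iff sum_nonneg)
  then have "W = transpose A" by (simp add: vec_eq_iff transpose_def)
  then show ?thesis
    using AW by (simp add: orthogonal_matrix matrix_left_right_inverse)
qed

lemma stretch_diff: "stretch d p - stretch d q = (real d + 1) *\<^sub>R (p - q)"
  by (simp add: stretch_def vec_eq_iff algebra_simps)

lemma column_stretch_matrix: "column j (stretch_matrix d r) = stretch d (\<chi> i. r i j)"
  by (simp add: column_def stretch_matrix_def stretch_def)

lemma meas_apply_eq_sum_stretch:
  "meas_apply d r q = (\<Sum>j\<in>UNIV. stretch d q $ j *\<^sub>R (\<chi> i. r i j))"
  by (simp add: meas_apply_def stretch_def vec_eq_iff)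

lemma stretched_mult_vec:
  assumes "q \<in> hyperH"
  shows "stretched d r *v q = meas_apply d r q"
proof -
  have q: "(\<Sum>j\<in>UNIV. q $ j) = 1" using assms by (simp add: hyperH_def)
  have "(stretched d r *v q) $ i = meas_apply d r q $ i" for i
  proof -
    have "(stretched d r *v q) $ i
        = (\<Sum>j\<in>UNIV. (real d + 1) * r i j * q $ j)
          - (\<Sum>j\<in>UNIV. (1 / real d) * (\<Sum>k\<in>UNIV. r i k) * q $ j)"
      by (simp add: stretched_def matrix_vector_mult_def algebra_simps sum_subtractf)
    also have "\<dots> = (real d + 1) * (\<Sum>j\<in>UNIV. r i j * q $ j)
        - (1 / real d) * (\<Sum>k\<in>UNIV. r i k) * (\<Sum>j\<in>UNIV. q $ j)"
      by (simp add: sum_distrib_left mult.assoc)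
    also have "\<dots> = (real d + 1) * (\<Sum>j\<in>UNIV. r i j * q $ j) - (1 / real d) * (\<Sum>k\<in>UNIV. r i k)"
      using q by simp
    also have "\<dots> = (\<Sum>j\<in>UNIV. (real d + 1) * q $ j * r i j) - (\<Sum>j\<in>UNIV. 1 / real d * r i j)"
      by (simp add: sum_distrib_left mult_ac sum_divide_distrib)
    also have "\<dots> = meas_apply d r q $ i"
      unfolding meas_apply_def by (simp add: left_diff_distrib sum_subtractf)
    finally show ?thesis .
  qed
  then show ?thesis by (simp add: vec_eq_iff)
qed

lemma unstretch_stretch: "unstretch d (stretch d x) = x"
  by (simp add: stretch_def unstretch_def vec_eq_iff)

context
  fixes d :: nat
  assumes d_pos: "d > 0"
begin

lemma stretch_unstretch: "stretch d (unstretch d x) = x"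
  using d_pos by (simp add: stretch_def unstretch_def vec_eq_iff)

lemma stretch_vertex: "stretch d (vertex d j) = axis j 1"
  by (simp add: vertex_def stretch_unstretch)

lemma meas_apply_vertex: "meas_apply d r (vertex d j) = (\<chi> i. r i j)"
  by (simp add: meas_apply_eq_sum_stretch stretch_vertex vec_eq_iff sum_component axis_def
      if_distrib[of "\<lambda>c. c * r _ _"] cong: if_cong)

lemma unstretch_affine_combination:
  assumes "sum a S = 1"
  shows "unstretch d (\<Sum>k\<in>S. a k *\<^sub>R x k) = (\<Sum>k\<in>S. a k *\<^sub>R unstretch d (x k))"
proof -
  have "(\<Sum>k\<in>S. a k * (x k $ j + 1 / real d)) = (\<Sum>k\<in>S. a k * x k $ j) + 1 / real d" for j
    using assms by (simp add: distrib_left sum.distrib flip: sum_distrib_right sum_divide_distrib)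
  then show ?thesis
    by (simp add: unstretch_def vec_eq_iff sum_component flip: sum_divide_distrib)
qed

end

context
  fixes d :: nat
  assumes d_pos: "d > 0" and card: "CARD('n::finite) = d^2"
begin

lemma sum_stretch:
  assumes "(q::real^'n) \<in> hyperH"
  shows "(\<Sum>j\<in>UNIV. stretch d q $ j) = 1"
proof -
  have "(\<Sum>j\<in>UNIV. stretch d q $ j) = (real d + 1) * (\<Sum>j\<in>UNIV. q $ j) - real CARD('n) / real d"
    by (simp add: stretch_def sum_subtractf sum_distrib_left)
  also have "\<dots> = 1" using assms d_pos by (simp add: hyperH_def card power2_eq_square)
  finally show ?thesis .
qed

lemma vertex_in_hyperH: "vertex d (j::'n) \<in> hyperH"
proof -
  have "(\<Sum>i\<in>UNIV. vertex d j $ i) = (1 + real CARD('n) / real d) / (real d + 1)"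
    by (simp add: vertex_def unstretch_def axis_def sum.distrib flip: sum_divide_distrib)
  also have "\<dots> = 1" using d_pos by (simp add: card power2_eq_square field_simps)
  finally show ?thesis by (simp add: hyperH_def)
qed

lemma hyperH_eq_sum_vertex:
  assumes "(q::real^'n) \<in> hyperH"
  shows "q = (\<Sum>j\<in>UNIV. stretch d q $ j *\<^sub>R vertex d j)"
proof -
  have "(\<Sum>j\<in>UNIV. stretch d q $ j *\<^sub>R axis j 1) = stretch d q"
    using basis_expansion[of "stretch d q"] by (simp add: scalar_mult_eq_scaleR)
  then have "q = unstretch d (\<Sum>j\<in>UNIV. stretch d q $ j *\<^sub>R axis j 1)"
    by (simp add: unstretch_stretch)
  also have "\<dots> = (\<Sum>j\<in>UNIV. stretch d q $ j *\<^sub>R vertex d j)"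
    using unstretch_affine_combination[OF d_pos sum_stretch[OF assms]] by (simp add: vertex_def)
  finally show ?thesis .
qed

lemma matrix_eq_if_eq_on_vertices:
  fixes M M' :: "real^'n^'n"
  assumes "\<And>j. M *v vertex d j = M' *v vertex d j"
  shows "M = M'"
proof -
  have "M *v x = M' *v x" if "x \<in> hyperH" for x
  proof -
    have "N *v x = (\<Sum>j\<in>UNIV. stretch d x $ j *\<^sub>R (N *v vertex d j))" for N :: "real^'n^'n"
      using arg_cong[OF hyperH_eq_sum_vertex[OF that], of "(*v) N"]
      by (simp add: vec.sum matrix_vector_mult_scaleR)
    then show ?thesis by (simp add: assms)
  qed
  moreover have "axis j 1 \<in> hyperH" for j :: 'n
    by (simp add: hyperH_def axis_def)
  ultimately show ?thesis by (simp add: matrix_eq_if_eq_on_basis)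
qed

lemma power2_norm_stretch:
  assumes "(q::real^'n) \<in> hyperH"
  shows "(norm (stretch d q))^2 = (real d + 1)^2 * (norm (q - centre d))^2 + 1 / (real d)^2"
proof -
  have stretch_eq: "stretch d q = (real d + 1) *\<^sub>R (q - centre d) + centre d"
    using d_pos by (simp add: stretch_def centre_def vec_eq_iff algebra_simps power2_eq_square)
  have "inner (q - centre d) (centre d) = (\<Sum>i\<in>UNIV. q $ i - 1 / (real d)^2) / (real d)^2"
    by (simp add: inner_vec_def centre_def sum_divide_distrib)
  also have "\<dots> = 0"
    using assms d_pos by (simp add: hyperH_def sum_subtractf card)
  finally have orth: "inner (q - centre d) (centre d) = 0" .
  have centre: "(norm (centre d :: real^'n))^2 = 1 / (real d)^2"
    unfolding power2_norm_eq_inner using d_pos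
    by (simp add: inner_vec_def centre_def card power2_eq_square)
  show ?thesis
    using dot_norm[of "(real d + 1) *\<^sub>R (q - centre d)" "centre d"]
    by (simp add: stretch_eq orth centre power_mult_distrib)
qed

lemma stretch_meas_apply:
  assumes "(x::real^'n) \<in> hyperH"
  shows "stretch d (meas_apply d r x) = stretch_matrix d r *v stretch d x"
proof -
  have "(stretch_matrix d r *v stretch d x) $ i
      = (real d + 1) * meas_apply d r x $ i - (\<Sum>j\<in>UNIV. stretch d x $ j) / real d" for i
    by (simp add: stretch_matrix_def matrix_vector_mult_def meas_apply_eq_sum_stretch sum_component
        algebra_simps sum_subtractf sum_distrib_left sum_divide_distrib)
  then show ?thesis
    by (simp add: sum_stretch[OF assms] vec_eq_iff stretch_def[of d "meas_apply d r x"])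
qed

lemma dist_meas_apply:
  assumes "orthogonal_matrix (stretch_matrix d r)" and "(p::real^'n) \<in> hyperH" and "q \<in> hyperH"
  shows "dist (meas_apply d r p) (meas_apply d r q) = dist p q"
proof -
  have "orthogonal_transformation ((*v) (stretch_matrix d r))"
    using assms(1) by (simp add: orthogonal_transformation_matrix)
  then have "norm (stretch d (meas_apply d r p) - stretch d (meas_apply d r q))
      = norm (stretch d p - stretch d q)"
    by (simp add: stretch_meas_apply assms(2,3) orthogonal_transformation_norm flip: vec.diff)
  then show ?thesis
    by (simp add: stretch_diff dist_norm)
qed

context
  fixes Q :: "(real^'n) set"
  assumes qplex: "qplex d Q"
begin

lemma Q_subset_hyperH: "Q \<subseteq> hyperH"
  using qplex by (auto simp: qplex_def prob_simplex_def hyperH_def)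

text \<open>Each vertex has inner product at least 1/(d(d+1)) with every probability vector, so it
  lies in the polar of the simplex, which is contained in the polar of Q.\<close>
lemma vertex_in_Q: "vertex d j \<in> Q"
proof -
  have "vertex d j \<in> polar d Q"
    unfolding polar_def
  proof (intro CollectI conjI vertex_in_hyperH ballI)
    fix w assume "w \<in> Q"
    then have w: "(\<Sum>i\<in>UNIV. w $ i) = 1" "w $ j \<ge> 0"
      using qplex by (auto simp: qplex_def prob_simplex_def)
    have "1 / (real d * (real d + 1)) = (0 + 1 / real d) / (real d + 1)"
      by simp
    also have "\<dots> \<le> (w $ j + 1 / real d) / (real d + 1)"
      using w by (intro divide_right_mono add_right_mono) simp_all
    also have "\<dots> = inner (vertex d j) w"
      by (simp add: inner_vec_def vertex_def unstretch_def axis_def algebra_simps sum.distrib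
          add_divide_distrib if_distrib[of "\<lambda>c. c * _"] if_distrib[of "\<lambda>c. _ * c"]
          cong: if_cong flip: sum_divide_distrib sum_distrib_left) (simp add: w)
    finally show "inner (vertex d j) w \<ge> 1 / (real d * (real d + 1))" .
  qed
  then show ?thesis using qplex by (simp add: qplex_def)
qed

text \<open>For q \<in> H this bound is equivalent to the out-ball condition.\<close>
lemma norm_stretch_le_1:
  assumes "q \<in> Q"
  shows "norm (stretch d q) \<le> 1"
proof -
  have "(norm (q - centre d))^2 \<le> (real d - 1) / ((real d)^2 * (real d + 1))"
    using assms qplex by (auto simp: qplex_def out_ball_def)
  moreover have "(norm (stretch d q))^2 = (real d + 1)^2 * (norm (q - centre d))^2 + 1 / (real d)^2"
    using assms Q_subset_hyperH by (auto intro: power2_norm_stretch)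
  ultimately have "(norm (stretch d q))^2
      \<le> (real d + 1)^2 * ((real d - 1) / ((real d)^2 * (real d + 1))) + 1 / (real d)^2"
    by (simp add: mult_left_mono del: times_divide_eq_right)
  also have "\<dots> = 1"
    using d_pos by (simp add: divide_simps power2_eq_square) (simp add: algebra_simps)
  finally show ?thesis by (simp add: power_le_one_iff)
qed

lemma orthogonal_stretch_matrix_if_Q_preserving:
  assumes "Q_preserving d Q r"
  shows "orthogonal_matrix (stretch_matrix d r)"
proof -
  have onto: "meas_apply d r ` Q = Q" using assms by (simp add: Q_preserving_def)
  then have "vertex d j \<in> meas_apply d r ` Q" for j
    using vertex_in_Q by simp
  then have "\<forall>j. \<exists>w\<in>Q. meas_apply d r w = vertex d j"
    by (metis image_iff)
  then obtain w where w: "\<And>j. w j \<in> Q" and w_vertex: "\<And>j. meas_apply d r (w j) = vertex d j"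
    by metis
  define W :: "real^'n^'n" where "W = transpose (\<chi> j. stretch d (w j))"
  have column_W: "column j W = stretch d (w j)" for j
    by (simp add: W_def column_def transpose_def)
  have "stretch_matrix d r ** W = mat 1"
  proof (rule matrix_eq_if_eq_on_basis)
    fix j
    have "(stretch_matrix d r ** W) *v axis j 1 = stretch_matrix d r *v (W *v axis j 1)"
      by (rule matrix_vector_mul_assoc[symmetric])
    also have "\<dots> = stretch_matrix d r *v stretch d (w j)"
      by (simp add: matrix_vector_mult_basis column_W)
    also have "\<dots> = stretch d (vertex d j)"
      using w Q_subset_hyperH by (simp add: subset_iff flip: w_vertex stretch_meas_apply)
    finally show "(stretch_matrix d r ** W) *v axis j 1 = mat 1 *v axis j 1"
      by (simp add: stretch_vertex[OF d_pos])
  qed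
  moreover have "norm (column j (stretch_matrix d r)) \<le> 1" for j
  proof -
    have "meas_apply d r (vertex d j) \<in> Q"
      using onto vertex_in_Q by blast
    then show ?thesis
      by (simp add: meas_apply_vertex[OF d_pos] column_stretch_matrix norm_stretch_le_1)
  qed
  moreover have "norm (column j W) \<le> 1" for j
    by (simp add: column_W norm_stretch_le_1 w)
  ultimately show ?thesis by (rule orthogonal_matrix_if_right_inverse_columns_le_1)
qed

lemma symmetry_stretched_if_Q_preserving:
  assumes "Q_preserving d Q r"
  shows "symmetry Q (\<lambda>q. stretched d r *v q)"
proof -
  have eq: "stretched d r *v q = meas_apply d r q" if "q \<in> Q" for q
    using that Q_subset_hyperH by (auto intro: stretched_mult_vec)
  have "(\<lambda>q. stretched d r *v q) ` Q = Q"
    using assms eq by (simp add: Q_preserving_def cong: image_cong)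
  moreover have "dist (stretched d r *v p) (stretched d r *v q) = dist p q"
    if "p \<in> Q" "q \<in> Q" for p q
    using that eq Q_subset_hyperH orthogonal_stretch_matrix_if_Q_preserving[OF assms]
    by (auto intro: dist_meas_apply)
  ultimately show ?thesis by (simp add: symmetry_def)
qed

lemma symmetry_represented_by_preservation_group:
  assumes f: "symmetry Q f"
  shows "\<exists>R\<in>preservation_group d Q. \<forall>q\<in>Q. f q = R *v q"
proof -
  define r where "r i j = f (vertex d j) $ i" for i j
  have f_vertex: "f (vertex d j) \<in> Q" for j
    using f vertex_in_Q by (auto simp: symmetry_def)
  have f_eq: "f q = meas_apply d r q" if "q \<in> Q" for q
  proof -
    have q: "q \<in> hyperH" using that Q_subset_hyperH by auto
    have iso: "\<And>x y. x \<in> Q \<Longrightarrow> y \<in> Q \<Longrightarrow> dist (f x) (f y) = dist x y"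
      using f by (simp add: symmetry_def)
    have "f q = (\<Sum>j\<in>UNIV. stretch d q $ j *\<^sub>R f (vertex d j))"
      by (rule isometry_affine_combination[OF iso that vertex_in_Q sum_stretch[OF q]
          hyperH_eq_sum_vertex[OF q]])
    then show ?thesis by (simp add: meas_apply_eq_sum_stretch r_def)
  qed
  have "measurement r"
    using f_vertex qplex by (auto simp: measurement_def r_def qplex_def prob_simplex_def)
  moreover have "meas_apply d r ` Q = Q"
    using f f_eq by (simp add: symmetry_def cong: image_cong)
  ultimately have "stretched d r \<in> preservation_group d Q"
    by (auto simp: preservation_group_def Q_preserving_def)
  moreover have "f q = stretched d r *v q" if "q \<in> Q" for q
    using that f_eq Q_subset_hyperH by (auto simp: stretched_mult_vec)
  ultimately show ?thesis by blast
qed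

lemma matrix_eq_if_eq_on_qplex:
  fixes M M' :: "real^'n^'n"
  assumes "\<And>q. q \<in> Q \<Longrightarrow> M *v q = M' *v q"
  shows "M = M'"
  using assms vertex_in_Q by (simp add: matrix_eq_if_eq_on_vertices)

lemma preservation_group_eq_symmetries:
  "preservation_group d Q = {R. symmetry Q (\<lambda>q. R *v q)}"
proof -
  have "symmetry Q (\<lambda>q. R *v q)" if "R \<in> preservation_group d Q" for R
    using that by (auto simp: preservation_group_def symmetry_stretched_if_Q_preserving)
  moreover have "R \<in> preservation_group d Q" if sym: "symmetry Q (\<lambda>q. R *v q)" for R
  proof -
    obtain R' where "R' \<in> preservation_group d Q" "\<forall>q\<in>Q. R *v q = R' *v q"
      using symmetry_represented_by_preservation_group[OF sym] by blast
    moreover then have "R = R'" by (simp add: matrix_eq_if_eq_on_qplex)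
    ultimately show ?thesis by simp
  qed
  ultimately show ?thesis by blast
qed

lemma group_preservation_group:
  "group \<lparr>carrier = preservation_group d Q, monoid.mult = (**), one = mat 1\<rparr>" (is "group ?G")
proof (rule groupI)
  fix x y assume "x \<in> carrier ?G" "y \<in> carrier ?G"
  then have "symmetry Q (\<lambda>q. x *v (y *v q))"
    by (simp add: preservation_group_eq_symmetries symmetry_comp)
  then show "x \<otimes>\<^bsub>?G\<^esub> y \<in> carrier ?G"
    by (simp add: preservation_group_eq_symmetries matrix_vector_mul_assoc)
next
  have mat_1: "(\<lambda>q. mat 1 *v q) = (\<lambda>q::real^'n. q)" by (simp add: fun_eq_iff)
  show "\<one>\<^bsub>?G\<^esub> \<in> carrier ?G"
    using symmetry_id[of Q] by (simp add: preservation_group_eq_symmetries mat_1)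
next
  fix x y z
  show "x \<otimes>\<^bsub>?G\<^esub> y \<otimes>\<^bsub>?G\<^esub> z = x \<otimes>\<^bsub>?G\<^esub> (y \<otimes>\<^bsub>?G\<^esub> z)"
    by (simp add: matrix_mul_assoc)
next
  fix x show "\<one>\<^bsub>?G\<^esub> \<otimes>\<^bsub>?G\<^esub> x = x" by simp
next
  fix x assume "x \<in> carrier ?G"
  then have x: "symmetry Q (\<lambda>q. x *v q)" by (simp add: preservation_group_eq_symmetries)
  obtain y where y: "y \<in> preservation_group d Q"
    and y_inv: "\<forall>q\<in>Q. inv_into Q (\<lambda>q. x *v q) q = y *v q"
    using symmetry_represented_by_preservation_group[OF symmetry_inv_into[OF x]] by blast
  have "y ** x = mat 1"
  proof (rule matrix_eq_if_eq_on_qplex)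
    fix q assume q: "q \<in> Q"
    then have "x *v q \<in> Q" using x by (auto simp: symmetry_def)
    then have "(y ** x) *v q = inv_into Q (\<lambda>q. x *v q) (x *v q)"
      using y_inv by (simp flip: matrix_vector_mul_assoc)
    also have "\<dots> = q"
      using x q by (simp add: symmetry_iff_bij_betw bij_betw_def inv_into_f_f)
    finally show "(y ** x) *v q = mat 1 *v q" by simp
  qed
  then show "\<exists>y\<in>carrier ?G. y \<otimes>\<^bsub>?G\<^esub> x = \<one>\<^bsub>?G\<^esub>" using y by auto
qed

end

end

theorem mainTheorem13:
  fixes d :: nat and Q :: "(real^'n::finite) set"
  assumes "d \<ge> 2" and "CARD('n) = d^2" and "qplex d Q"
  shows "group \<lparr>carrier = preservation_group d Q, monoid.mult = (**), one = mat 1\<rparr>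
     \<and> (\<forall>R\<in>preservation_group d Q.
           bij_betw (\<lambda>q. R *v q) Q Q \<and> (\<forall>p\<in>Q. \<forall>q\<in>Q. dist (R *v p) (R *v q) = dist p q))
     \<and> (\<forall>f. bij_betw f Q Q \<and> (\<forall>p\<in>Q. \<forall>q\<in>Q. dist (f p) (f q) = dist p q)
           \<longrightarrow> (\<exists>R\<in>preservation_group d Q. \<forall>q\<in>Q. f q = R *v q))"
proof -
  have d_pos: "d > 0" using assms(1) by simp
  note setting = d_pos assms(2,3)
  show ?thesis
    using group_preservation_group[OF setting] preservation_group_eq_symmetries[OF setting]
      symmetry_represented_by_preservation_group[OF setting]
    by (auto simp: symmetry_iff_bij_betw)
qed


end
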